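(* Let $a>0$ with $a\neq 1$, and let $\sigma:\mathbb{R}\to\mathbb{R}$ be a twice differentiable function with $\sigma(t)>0$, $\sigma'(t)>0$ and $\sigma''(t)>0$ for all $t>0$, and such that $$t\,\sigma''(t)\,\sigma(t)+\sigma(t)\,\sigma'(t)\ \ge\ t\,(\sigma'(t))^2\qquad\text{for all } t>0.$$ Let $d_0,d_1,d_2\ge 1$ and let $x\in\mathbb{R}^{d_0}$ have all entries strictly positive. For $W=(W_0,W_1)$ with $W_0\in\mathbb{R}^{d_1\times d_0}$ and $W_1\in\mathbb{R}^{d_2\times d_1}$, let $$f_{a,2}(W,x)=a^{W_1}\,\sigma\big(a^{W_0}x\big)\in\mathbb{R}^{d_2}$$ be the two-layer exponential multilayer neural network. Then $f_{a,2}(W,x)$ is convex with respect to $W$, i.e. $f_{a,2}$ is a Parameter Convex Neural Network.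
   Context: For a real matrix $M$ and $a>0$, $a^{M}$ denotes the matrix of the same size with entries $a^{M_{ij}}$ (entrywise exponential); products such as $a^{W_0}x$ are ordinary matrix products. A scalar function $\sigma$ applied to a vector acts entrywise. A matrix- or vector-valued function of parameters $W$ (a tuple of matrices) is called convex with respect to $W$ if each of its entries is a convex real-valued function of the column vector obtained by listing all the entries of $W$. A neural network $F(x,\theta)$ with input $x$ and parameters $\theta$ is a Parameter Convex Neural Network (PCNN) if it is convex with respect to $\theta$ (for each admissible fixed input $x$). *)

theory Defs
  imports "HOL-Analysis.Analysis"
begin

definition entrywise_powr :: "real \<Rightarrow> real ^ 'n ^ 'm \<Rightarrow> real ^ 'n ^ 'm" where
  "entrywise_powr a M = (\<chi> i j. a powr (M $ i $ j))"

definition apply_entrywise :: "(real \<Rightarrow> real) \<Rightarrow> real ^ 'n \<Rightarrow> real ^ 'n" where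
  "apply_entrywise \<sigma> v = (\<chi> i. \<sigma> (v $ i))"

text \<open>A tuple of matrices is an element of a product type, whose vector space operations act
  entry by entry.  Convexity over that type is therefore joint convexity in all the entries of
  all the matrices, listed as one vector.\<close>

definition convex_in_params :: "('p::real_vector \<Rightarrow> real ^ 'k) \<Rightarrow> bool" where
  "convex_in_params G \<longleftrightarrow> (\<forall>i. convex_on UNIV (\<lambda>W. G W $ i))"

text \<open>The set \<open>X\<close> consists of the admissible inputs; the parameters range over the whole
  parameter space.\<close>

definition PCNN :: "(real ^ 'n) set \<Rightarrow> ('p::real_vector \<Rightarrow> real ^ 'n \<Rightarrow> real ^ 'k) \<Rightarrow> bool" where
  "PCNN X F \<longleftrightarrow> (\<forall>x\<in>X. convex_in_params (\<lambda>W. F W x))"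

definition exp_mlp2 ::
  "real \<Rightarrow> (real \<Rightarrow> real) \<Rightarrow> (real ^ 'd0 ^ 'd1) \<times> (real ^ 'd1 ^ 'd2) \<Rightarrow> real ^ 'd0 \<Rightarrow> real ^ 'd2"
  where
  "exp_mlp2 a \<sigma> W x =
     entrywise_powr a (snd W) *v apply_entrywise \<sigma> (entrywise_powr a (fst W) *v x)"

end

theory Submission
  imports Defs
begin

text \<open>An entry of the network is a sum over \<open>j\<close> of terms
  \<open>exp (ln a * W\<^sub>1 $ i $ j + g (ln u\<^sub>j))\<close> with \<open>u\<^sub>j = (\<Sum>k. a powr (W\<^sub>0 $ j $ k) * x $ k)\<close> and
  \<open>g s = ln (\<sigma> (exp s))\<close>.  Here \<open>ln u\<^sub>j\<close> is a log-sum-exp of affine functions of \<open>W\<^sub>0\<close>, hence convex;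
  the differential inequality for \<open>\<sigma>\<close> says exactly that \<open>g\<close> is convex, and \<open>\<sigma>' > 0\<close> that it is
  increasing.\<close>

text \<open>Convexity of \<open>f\<close> bounds \<open>f\<close> at a mixture only from above, so
  \<open>g\<close> has to preserve the inequality before its own convexity is used. It serves twice:
  for \<sigma> in logarithmic coordinates and for the outer \<open>exp\<close>.\<close>

lemma convex_on_compose_mono:
  fixes g :: "real \<Rightarrow> real"
  assumes "convex_on UNIV g" "mono g" "convex_on S f"
  shows "convex_on S (\<lambda>x. g (f x))"
  unfolding convex_on_def
proof (intro conjI ballI allI impI)
  show "convex S" using assms(3) by (rule convex_on_imp_convex)
  fix x y and u v :: real
  assume *: "x \<in> S" "y \<in> S" "u \<ge> 0" "v \<ge> 0" "u + v = 1"
  have "f (u *\<^sub>R x + v *\<^sub>R y) \<le> u * f x + v * f y"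
    using assms(3) * by (simp add: convex_on_def)
  then have "g (f (u *\<^sub>R x + v *\<^sub>R y)) \<le> g (u *\<^sub>R f x + v *\<^sub>R f y)"
    using assms(2) by (simp add: monoD)
  also have "\<dots> \<le> u * g (f x) + v * g (f y)"
    using assms(1) * by (simp only: convex_on_def UNIV_I Ball_def)
  finally show "g (f (u *\<^sub>R x + v *\<^sub>R y)) \<le> u * g (f x) + v * g (f y)" .
qed

lemma convex_on_sum_fun:
  fixes f :: "'i \<Rightarrow> 'a::real_vector \<Rightarrow> real"
  assumes "finite I" "convex S" "\<And>i. i \<in> I \<Longrightarrow> convex_on S (f i)"
  shows "convex_on S (\<lambda>x. \<Sum>i\<in>I. f i x)"
  using assms(1,3)
  by (induction I rule: finite_induct) (auto simp: convex_on_const assms(2))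

lemma convex_on_affine:
  fixes f :: "'a::real_vector \<Rightarrow> real"
  assumes "linear f" "convex S"
  shows "convex_on S (\<lambda>x. f x + c)"
proof (rule convex_on_add)
  show "convex_on S f"
    using assms by (simp add: convex_on_def linear_add linear_scale)
qed (simp add: convex_on_const assms)

text \<open>This is Hoelder's inequality in logarithmic form. Its usual proof is followed: normalise
  the summands to weights of total 1, then apply weighted AM-GM, that is, convexity of
  \<open>exp\<close>. No differentiability of the \<open>f i\<close> enters.\<close>

lemma convex_on_ln_sum_exp:
  fixes f :: "'i \<Rightarrow> 'a::real_vector \<Rightarrow> real"
  assumes "finite I" "I \<noteq> {}" and f: "\<And>i. i \<in> I \<Longrightarrow> convex_on S (f i)"
  shows "convex_on S (\<lambda>x. ln (\<Sum>i\<in>I. exp (f i x)))"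
  unfolding convex_on_def
proof (intro conjI ballI allI impI)
  show "convex S" using assms by (auto intro: convex_on_imp_convex)
  define s where "s z = (\<Sum>i\<in>I. exp (f i z))" for z
  have pos: "s z > 0" for z
    unfolding s_def using assms(1,2) by (intro sum_pos) auto
  fix x y and u v :: real
  assume *: "x \<in> S" "y \<in> S" "u \<ge> 0" "v \<ge> 0" "u + v = 1"
  let ?m = "u * ln (s x) + v * ln (s y)"
  \<comment> \<open>Factoring out \<open>exp ?m\<close> leaves a mixture of the logarithms of the
    weights \<open>exp (f i x) / s x\<close> and \<open>exp (f i y) / s y\<close> in the
    exponent.\<close>
  have summand: "exp (f i (u *\<^sub>R x + v *\<^sub>R y)) \<le> exp ?m * (u * (exp (f i x) / s x) + v * (exp (f i y) / s y))"
    if "i \<in> I" for i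
  proof -
    have "f i (u *\<^sub>R x + v *\<^sub>R y) \<le> u * f i x + v * f i y"
      using f[OF that] * by (simp add: convex_on_def)
    then have "exp (f i (u *\<^sub>R x + v *\<^sub>R y))
        \<le> exp (?m + (u *\<^sub>R (f i x - ln (s x)) + v *\<^sub>R (f i y - ln (s y))))"
      by (simp add: algebra_simps)
    also have "\<dots> = exp ?m * exp (u *\<^sub>R (f i x - ln (s x)) + v *\<^sub>R (f i y - ln (s y)))"
      by (rule exp_add)
    also have "\<dots> \<le> exp ?m * (u * exp (f i x - ln (s x)) + v * exp (f i y - ln (s y)))"
      using exp_convex * by (intro mult_left_mono) (simp_all only: convex_on_def UNIV_I Ball_def exp_ge_zero)
    finally show ?thesis using pos by (simp add: exp_diff)
  qed
  have "s (u *\<^sub>R x + v *\<^sub>R y) \<le> (\<Sum>i\<in>I. exp ?m * (u * (exp (f i x) / s x) + v * (exp (f i y) / s y)))"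
    unfolding s_def[of "u *\<^sub>R x + v *\<^sub>R y"] by (intro sum_mono summand)
  \<comment> \<open>Each family of weights sums to 1, so the bracket collapses to
    \<open>u + v = 1\<close>.\<close>
  also have "\<dots> = exp ?m * (u * (s x / s x) + v * (s y / s y))"
    by (simp add: s_def[of x, symmetric] s_def[of y, symmetric] sum.distrib
        flip: sum_distrib_left sum_divide_distrib)
  also have "\<dots> = exp ?m"
    using pos[of x] pos[of y] * by simp
  finally have "s (u *\<^sub>R x + v *\<^sub>R y) \<le> exp ?m" .
  then show "ln (\<Sum>i\<in>I. exp (f i (u *\<^sub>R x + v *\<^sub>R y)))
      \<le> u * ln (\<Sum>i\<in>I. exp (f i x)) + v * ln (\<Sum>i\<in>I. exp (f i y))"
    using pos[of "u *\<^sub>R x + v *\<^sub>R y"] ln_mono[of "s (u *\<^sub>R x + v *\<^sub>R y)" "exp ?m"]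
    by (simp add: s_def)
qed

lemma mono_ln_comp_exp:
  fixes \<sigma> \<sigma>' :: "real \<Rightarrow> real"
  assumes d: "\<And>t. t > 0 \<Longrightarrow> (\<sigma> has_real_derivative \<sigma>' t) (at t)"
    and pos: "\<And>t. t > 0 \<Longrightarrow> \<sigma> t > 0"
    and "\<And>t. t > 0 \<Longrightarrow> \<sigma>' t \<ge> 0"
  shows "mono (\<lambda>s. ln (\<sigma> (exp s)))"
proof (rule monoI)
  fix r s :: real
  assume "r \<le> s"
  have "\<sigma> (exp r) \<le> \<sigma> (exp s)"
  proof (rule DERIV_nonneg_imp_nondecreasing[where f = \<sigma>])
    fix t assume "exp r \<le> t"
    then have "t > 0" by (rule order_less_le_trans[OF exp_gt_zero])
    then show "\<exists>y. (\<sigma> has_real_derivative y) (at t) \<and> y \<ge> 0"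
      using assms by blast
  qed (use \<open>r \<le> s\<close> in simp)
  then show "ln (\<sigma> (exp r)) \<le> ln (\<sigma> (exp s))"
    using pos by (simp add: ln_mono)
qed

text \<open>The first derivative is the elasticity \<open>t * \<sigma>' t / \<sigma> t\<close> at
  \<open>t = exp s\<close>. The quotient rule turns the claim that it is nondecreasing into
  \<open>ineq\<close>, up to the positive factor \<open>t / (\<sigma> t)\<^sup>2\<close>.\<close>

lemma convex_on_ln_comp_exp:
  fixes \<sigma> \<sigma>' \<sigma>'' :: "real \<Rightarrow> real"
  assumes d: "\<And>t. t > 0 \<Longrightarrow> (\<sigma> has_real_derivative \<sigma>' t) (at t)"
    and d': "\<And>t. t > 0 \<Longrightarrow> (\<sigma>' has_real_derivative \<sigma>'' t) (at t)"
    and pos: "\<And>t. t > 0 \<Longrightarrow> \<sigma> t > 0"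
    and ineq: "\<And>t. t > 0 \<Longrightarrow> t * \<sigma>'' t * \<sigma> t + \<sigma> t * \<sigma>' t \<ge> t * (\<sigma>' t)\<^sup>2"
  shows "convex_on UNIV (\<lambda>s. ln (\<sigma> (exp s)))"
proof (rule f''_ge0_imp_convex)
  note chain = DERIV_chain2[OF d[OF exp_gt_zero] DERIV_exp] DERIV_chain2[OF d'[OF exp_gt_zero] DERIV_exp]
  note nz = pos[OF exp_gt_zero, THEN less_imp_neq, symmetric]
  show "((\<lambda>s. ln (\<sigma> (exp s))) has_real_derivative exp s * \<sigma>' (exp s) / \<sigma> (exp s)) (at s)" for s
    using pos[of "exp s"] by (auto intro!: derivative_eq_intros chain)
  show "((\<lambda>s. exp s * \<sigma>' (exp s) / \<sigma> (exp s)) has_real_derivative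
      exp s * (exp s * \<sigma>'' (exp s) * \<sigma> (exp s) + \<sigma> (exp s) * \<sigma>' (exp s) - exp s * (\<sigma>' (exp s))\<^sup>2)
        / (\<sigma> (exp s))\<^sup>2) (at s)" for s
    using nz[of s]
    by (auto intro!: derivative_eq_intros chain simp: field_simps power2_eq_square)
  show "exp s * (exp s * \<sigma>'' (exp s) * \<sigma> (exp s) + \<sigma> (exp s) * \<sigma>' (exp s) - exp s * (\<sigma>' (exp s))\<^sup>2)
        / (\<sigma> (exp s))\<^sup>2 \<ge> 0" for s
    using ineq[of "exp s"] by simp
qed simp

text \<open>The sign of \<open>c\<close> is free: with \<open>c = ln a\<close>, bases below and
  above 1 are treated alike.\<close>

lemma linear_fst_entry: "linear (\<lambda>W :: (real ^ 'n ^ 'm) \<times> 'b::real_vector. c * fst W $ j $ k)"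
  and linear_snd_entry: "linear (\<lambda>W :: 'b::real_vector \<times> (real ^ 'n ^ 'm). c * snd W $ j $ k)"
  by (rule linearI; simp add: algebra_simps)+

theorem theorem2:
  fixes a :: real and \<sigma> \<sigma>' \<sigma>'' :: "real \<Rightarrow> real"
  assumes "a > 0" and "a \<noteq> 1"
    and "\<And>t. (\<sigma> has_real_derivative \<sigma>' t) (at t)"
    and "\<And>t. (\<sigma>' has_real_derivative \<sigma>'' t) (at t)"
    and "\<And>t. t > 0 \<Longrightarrow> \<sigma> t > 0"
    and "\<And>t. t > 0 \<Longrightarrow> \<sigma>' t > 0"
    and "\<And>t. t > 0 \<Longrightarrow> \<sigma>'' t > 0"
    and "\<And>t. t > 0 \<Longrightarrow> t * \<sigma>'' t * \<sigma> t + \<sigma> t * \<sigma>' t \<ge> t * (\<sigma>' t)\<^sup>2"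
  shows "PCNN {x :: real ^ 'd0. \<forall>i. x $ i > 0}
    (exp_mlp2 a \<sigma> :: (real ^ 'd0 ^ 'd1) \<times> (real ^ 'd1 ^ 'd2) \<Rightarrow> real ^ 'd0 \<Rightarrow> real ^ 'd2)"
  unfolding PCNN_def convex_in_params_def
proof (intro ballI allI)
  fix x :: "real ^ 'd0" and i :: 'd2
  assume "x \<in> {x. \<forall>i. x $ i > 0}"
  then have x: "x $ k > 0" for k by simp
  let ?g = "\<lambda>s. ln (\<sigma> (exp s))"
  \<comment> \<open>Positivity of the inputs lets each \<open>x $ k\<close> move into the exponent
    as the constant \<open>ln (x $ k)\<close>.\<close>
  define l :: "'d1 \<Rightarrow> (real ^ 'd0 ^ 'd1) \<times> (real ^ 'd1 ^ 'd2) \<Rightarrow> real"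
    where "l j W = ln (\<Sum>k\<in>UNIV. exp (ln a * fst W $ j $ k + ln (x $ k)))" for j W
  have mono: "mono ?g"
    using assms by (intro mono_ln_comp_exp) (auto intro: less_imp_le)
  have conv: "convex_on UNIV ?g"
    using assms by (intro convex_on_ln_comp_exp)
  have l: "convex_on UNIV (l j)" for j
    unfolding l_def by (intro convex_on_ln_sum_exp convex_on_affine linear_fst_entry) auto
  have snd: "convex_on UNIV (\<lambda>W :: (real ^ 'd0 ^ 'd1) \<times> (real ^ 'd1 ^ 'd2). ln a * snd W $ i $ j)" for j
    using convex_on_affine[where c = 0, OF linear_snd_entry convex_UNIV] by simp
  \<comment> \<open>A product of convex functions need not be convex. Here the product of a weight
    and an activation becomes a sum of exponents, each convex in the whole pair \<open>W\<close>,
    and the increasing convex \<open>exp\<close> keeps this.\<close>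
  have sum_conv: "convex_on UNIV (\<lambda>W. \<Sum>j\<in>UNIV. exp (ln a * snd W $ i $ j + ?g (l j W)))"
    by (intro convex_on_sum_fun convex_on_compose_mono[OF exp_convex] convex_on_add snd
        convex_on_compose_mono[OF conv mono l]) (auto simp: mono_def)
  have entry: "exp_mlp2 a \<sigma> W x $ i = (\<Sum>j\<in>UNIV. exp (ln a * snd W $ i $ j + ?g (l j W)))" for W
  proof -
    have l_eq: "exp (l j W) = (\<Sum>k\<in>UNIV. a powr (fst W $ j $ k) * x $ k)" for j
    proof -
      have "exp (l j W) = (\<Sum>k\<in>UNIV. exp (ln a * fst W $ j $ k + ln (x $ k)))"
        unfolding l_def by (intro exp_ln sum_pos) auto
      then show ?thesis
        using \<open>a > 0\<close> x by (simp add: exp_add powr_def mult.commute)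
    qed
    \<comment> \<open>The outer \<open>exp\<close> cancels the \<open>ln\<close> in
      \<open>?g\<close> because \<sigma> is positive at the positive point
      \<open>exp (l j W)\<close>.\<close>
    have "exp (ln a * snd W $ i $ j + ?g (l j W)) = a powr (snd W $ i $ j) * \<sigma> (exp (l j W))" for j
      using \<open>a > 0\<close> assms(5) by (simp add: exp_add powr_def mult.commute)
    then show ?thesis
      by (simp add: exp_mlp2_def entrywise_powr_def apply_entrywise_def matrix_vector_mult_def l_eq)
  qed
  show "convex_on UNIV (\<lambda>W :: (real ^ 'd0 ^ 'd1) \<times> (real ^ 'd1 ^ 'd2). exp_mlp2 a \<sigma> W x $ i)"
    unfolding entry by (rule sum_conv)
qed

end
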